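(* The non-negative integer solutions $(n,m,k)$ with $n \geq m$ of the Diophantine equation \[ J_n + J_m = L_k \] are exactly \[ (1,1,0),\ (2,1,0),\ (2,2,0),\ (1,0,1),\ (2,0,1),\ (3,0,2),\ (3,1,3),\ (3,2,3),\ (5,0,5). \]
   Context: $(L_k)_{k\geq 0}$ is the Lucas sequence: $L_0=2$, $L_1=1$, $L_{k+2}=L_{k+1}+L_k$ for all $k\geq 0$. $(J_n)_{n\geq 0}$ is the Jacobsthal sequence: $J_0=0$, $J_1=1$, $J_{n+2}=J_{n+1}+2J_n$ for all $n\geq 0$. *)

theory Defs
  imports Main
begin

fun lucas :: "nat \<Rightarrow> nat" where
  "lucas 0 = 2"
| "lucas (Suc 0) = 1"
| "lucas (Suc (Suc k)) = lucas (Suc k) + lucas k"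

fun jacobsthal :: "nat \<Rightarrow> nat" where
  "jacobsthal 0 = 0"
| "jacobsthal (Suc 0) = 1"
| "jacobsthal (Suc (Suc n)) = jacobsthal (Suc n) + 2 * jacobsthal n"

end

theory Submission
  imports Defs
begin

text \<open>
  For \<open>n \<ge> 4\<close> the residue of \<open>J\<^sub>n\<close> modulo 16 depends only on the parity of \<open>n\<close>, and comparing
  with the residues of the Lucas numbers modulo 16 forces \<open>m \<le> 2\<close> as soon as \<open>n \<ge> 4\<close>. There remain
  the equations \<open>J\<^sub>n + c = L\<^sub>k\<close> with \<open>c \<in> {0, 1}\<close>. For \<open>n \<ge> 6\<close> the residue of \<open>J\<^sub>n\<close> modulo 64
  depends only on the parity of \<open>n\<close>, which confines \<open>k\<close> to a few classes modulo 96; each of them is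
  excluded modulo one of the primes 7, 23, 37, 47, whose Lucas periods 16, 48, 76, 32 have a
  common factor with 96.
\<close>

section \<open>Certified periods of second-order recurrences\<close>

text \<open>
  Runs \<open>(a, b) \<mapsto> (b, (b + q a) mod M)\<close> for \<open>t\<close> steps, testing \<open>P\<close> along the way, and demands that
  the orbit ends in \<open>(c, d)\<close>. Taking \<open>(c, d)\<close> to be the initial pair certifies a period, so a
  single evaluation decides a statement about all residues.
\<close>

fun cycle_all :: "(nat \<Rightarrow> nat \<Rightarrow> bool) \<Rightarrow> nat \<Rightarrow> nat \<Rightarrow> nat \<Rightarrow> nat \<Rightarrow> nat \<Rightarrow> nat \<Rightarrow> nat \<Rightarrow> nat \<Rightarrow> bool" where
  "cycle_all P q M c d i 0 a b \<longleftrightarrow> a = c \<and> b = d"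
| "cycle_all P q M c d i (Suc t) a b \<longleftrightarrow> P i a \<and> cycle_all P q M c d (Suc i) t b ((b + q * a) mod M)"

text \<open>Lets \<open>simp\<close> evaluate the orbit when the step count is a literal such as
  \<open>96\<close>.\<close>

lemma cycle_all_numeral [simp]:
  "cycle_all P q M c d i (numeral v) a b \<longleftrightarrow>
    P i a \<and> cycle_all P q M c d (Suc i) (pred_numeral v) b ((b + q * a) mod M)"
  by (simp add: numeral_eq_Suc)

context
  fixes s :: "nat \<Rightarrow> nat" and q :: nat
  assumes rec: "\<And>k. s (Suc (Suc k)) = s (Suc k) + q * s k"
begin

lemma rec_mod: "s (Suc (Suc k)) mod M = (s (Suc k) mod M + q * (s k mod M)) mod M"
  by (metis rec mod_add_left_eq mod_add_right_eq mod_mult_right_eq)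

lemma cycle_allD:
  assumes "cycle_all P q M c d i t (s i mod M) (s (Suc i) mod M)"
  shows "(\<forall>j. i \<le> j \<and> j < i + t \<longrightarrow> P j (s j mod M)) \<and>
    s (i + t) mod M = c \<and> s (Suc (i + t)) mod M = d"
  using assms
proof (induction t arbitrary: i)
  case 0
  then show ?case by auto
next
  case (Suc t)
  then have "P i (s i mod M)"
    and "cycle_all P q M c d (Suc i) t (s (Suc i) mod M) (s (Suc (Suc i)) mod M)"
    by (simp_all add: rec_mod)
  with Suc.IH[of "Suc i"] show ?case
    by (auto simp: le_eq_less_or_eq[of i] Suc_le_eq)
qed

lemma cycle_all_residue:
  assumes "cycle_all P q M (s 0 mod M) (s 1 mod M) 0 T (s 0 mod M) (s 1 mod M)" and "T > 0"
  shows "P (k mod T) (s k mod M)"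
proof -
  have P: "P j (s j mod M)" if "j < T" for j
    using cycle_allD[of P M _ _ 0 T] assms(1) that by simp
  have start: "s T mod M = s 0 mod M" "s (Suc T) mod M = s 1 mod M"
    using cycle_allD[of P M _ _ 0 T] assms(1) by simp_all
  \<comment> \<open>Both conjuncts go through the induction together because the recurrence needs
    two consecutive values.\<close>
  have "s (T + j) mod M = s j mod M \<and> s (Suc (T + j)) mod M = s (Suc j) mod M" for j
    using start by (induction j) (simp_all add: rec_mod)
  then have "s (j + T * i) mod M = s j mod M" for i j
    by (induction i) (simp, metis add.assoc add.commute mult_Suc_right)
  from this[of "k mod T" "k div T"] have "s k mod M = s (k mod T) mod M"
    by simp
  with P[of "k mod T"] \<open>T > 0\<close> show ?thesis by simp
qed

end

lemmas lucas_residue = cycle_all_residue[where s = lucas and q = 1, simplified]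
lemmas jacobsthal_residue = cycle_all_residue[where s = jacobsthal and q = 2, simplified]

section \<open>Lucas residues\<close>

text \<open>The excluded residues are exactly the sums of one of 5, 11 and one of 3, 5, 11; moreover
  6 = 5 + 1.\<close>

lemma lucas_mod_16: "lucas k mod 16 \<notin> {0, 6, 8, 10, 14}"
  by (rule lucas_residue[where P = "\<lambda>_ x. x \<notin> {0, 6, 8, 10, 14}" and T = 24]) simp_all

text \<open>44 = 43 + 1 arises from odd \<open>n\<close>; 16 is the Lucas period modulo 7.\<close>

lemma lucas_mod_64_eq_44: "lucas k mod 64 = 44 \<Longrightarrow> k mod 16 = 1"
proof -
  have "lucas k mod 64 = 44 \<longrightarrow> (k mod 96) mod 16 = 1"
    by (rule lucas_residue[where P = "\<lambda>i x. x = 44 \<longrightarrow> i mod 16 = 1" and T = 96]) simp_all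
  then show "lucas k mod 64 = 44 \<Longrightarrow> k mod 16 = 1"
    by (simp add: mod_mod_cancel)
qed

text \<open>21 arises from even \<open>n\<close>. Modulo 37 only \<open>k mod 4\<close> can be used,
  since gcd(96, 76) = 4.\<close>

lemma lucas_mod_64_eq_21: "lucas k mod 64 = 21 \<Longrightarrow> k mod 4 = 3"
proof -
  have "lucas k mod 64 = 21 \<longrightarrow> (k mod 96) mod 4 = 3"
    by (rule lucas_residue[where P = "\<lambda>i x. x = 21 \<longrightarrow> i mod 4 = 3" and T = 96]) simp_all
  then show "lucas k mod 64 = 21 \<Longrightarrow> k mod 4 = 3"
    by (simp add: mod_mod_cancel)
qed

text \<open>43 arises from odd \<open>n\<close>; the classes are stated modulo the Lucas periods of
  23 and 47.\<close>

lemma lucas_mod_64_eq_43: "lucas k mod 64 = 43 \<Longrightarrow> k mod 48 \<in> {14, 34} \<or> k mod 32 = 21"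
proof -
  have "lucas k mod 64 = 43 \<longrightarrow> (k mod 96) mod 48 \<in> {14, 34} \<or> (k mod 96) mod 32 = 21"
    by (rule lucas_residue[where P = "\<lambda>i x. x = 43 \<longrightarrow> i mod 48 \<in> {14, 34} \<or> i mod 32 = 21"
        and T = 96]) simp_all
  then show "lucas k mod 64 = 43 \<Longrightarrow> k mod 48 \<in> {14, 34} \<or> k mod 32 = 21"
    by (simp add: mod_mod_cancel)
qed

lemma lucas_mod_7: "k mod 16 = 1 \<Longrightarrow> lucas k mod 7 = 1"
  using lucas_residue[of "\<lambda>i x. i = 1 \<longrightarrow> x = 1" 7 16 k] by simp

lemma lucas_mod_23: "k mod 48 \<in> {14, 34} \<Longrightarrow> lucas k mod 23 = 15"
  using lucas_residue[of "\<lambda>i x. i \<in> {14, 34} \<longrightarrow> x = 15" 23 48 k] by simp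

lemma lucas_mod_47: "k mod 32 = 21 \<Longrightarrow> lucas k mod 47 = 36"
  using lucas_residue[of "\<lambda>i x. i = 21 \<longrightarrow> x = 36" 47 32 k] by simp

lemma lucas_mod_37:
  assumes "k mod 4 = 3"
  shows "lucas k mod 37 \<in> {4, 14, 18, 25, 26, 29, 32, 34, 35, 36}"
proof -
  have "(k mod 76) mod 4 = 3 \<longrightarrow> lucas k mod 37 \<in> {4, 14, 18, 25, 26, 29, 32, 34, 35, 36}"
    by (rule lucas_residue[where T = 76 and
        P = "\<lambda>i x. i mod 4 = 3 \<longrightarrow> x \<in> {4, 14, 18, 25, 26, 29, 32, 34, 35, 36}"]) simp_all
  with assms show ?thesis by (simp add: mod_mod_cancel)
qed

section \<open>Jacobsthal residues\<close>

text \<open>By 3 J_n = 2^n - (-1)^n, p - 1 is a period modulo any prime p > 3. For even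
  \<open>n\<close>, 3 J_n + 1 is a square, while 3 x + 1 is a non-residue modulo 37 for every listed
  x.\<close>

lemma jacobsthal_mod_37:
  assumes "even n"
  shows "jacobsthal n mod 37 \<notin> {4, 14, 18, 25, 26, 29, 32, 34, 35, 36}"
proof -
  have "even (n mod 36) \<longrightarrow> jacobsthal n mod 37 \<notin> {4, 14, 18, 25, 26, 29, 32, 34, 35, 36}"
    by (rule jacobsthal_residue[where T = 36 and
        P = "\<lambda>i x. even i \<longrightarrow> x \<notin> {4, 14, 18, 25, 26, 29, 32, 34, 35, 36}"]) simp_all
  with assms show ?thesis by (simp add: dvd_mod_iff)
qed

text \<open>For odd \<open>n\<close>, 3 J_n - 1 = 2^n is a quadratic residue modulo 23, as 2 is, but
  3 * 15 - 1 is not. The same argument excludes 36 modulo 47 and 0 modulo 7.\<close>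

lemma odd_jacobsthal_mod_23:
  assumes "odd n"
  shows "jacobsthal n mod 23 \<noteq> 15"
proof -
  have "odd (n mod 22) \<longrightarrow> jacobsthal n mod 23 \<noteq> 15"
    by (rule jacobsthal_residue[where T = 22 and P = "\<lambda>i x. odd i \<longrightarrow> x \<noteq> 15"]) simp_all
  with assms show ?thesis by (simp add: dvd_mod_iff)
qed

lemma odd_jacobsthal_mod_47:
  assumes "odd n"
  shows "jacobsthal n mod 47 \<noteq> 36"
proof -
  have "odd (n mod 46) \<longrightarrow> jacobsthal n mod 47 \<noteq> 36"
    by (rule jacobsthal_residue[where T = 46 and P = "\<lambda>i x. odd i \<longrightarrow> x \<noteq> 36"]) simp_all
  with assms show ?thesis by (simp add: dvd_mod_iff)
qed

lemma odd_jacobsthal_mod_7: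
  assumes "odd n"
  shows "jacobsthal n mod 7 \<noteq> 0"
proof -
  have "odd (n mod 6) \<longrightarrow> jacobsthal n mod 7 \<noteq> 0"
    by (rule jacobsthal_residue[where T = 6 and P = "\<lambda>i x. odd i \<longrightarrow> x \<noteq> 0"]) simp_all
  with assms show ?thesis by (simp add: dvd_mod_iff)
qed

lemma jacobsthal_values:
  "jacobsthal 1 = 1" "jacobsthal 2 = 1" "jacobsthal 3 = 3" "jacobsthal 4 = 5" "jacobsthal 5 = 11"
  "jacobsthal 6 = 21" "jacobsthal 7 = 43"
  by (simp_all add: eval_nat_numeral)

text \<open>Modulo 2^r the sequence is periodic only from index r on, where 2^n vanishes; the shift
  drops the earlier terms.\<close>

lemma jacobsthal_shift_rec:
  "jacobsthal (Suc (Suc k) + d) = jacobsthal (Suc k + d) + 2 * jacobsthal (k + d)"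
  by simp

lemma jacobsthal_mod_16:
  assumes "n \<ge> 4"
  shows "jacobsthal n mod 16 = (if even n then 5 else 11)"
proof -
  obtain j where n: "n = j + 4" using assms by (metis add.commute le_Suc_ex)
  have "jacobsthal (j + 4) mod 16 = (if even (j mod 2) then 5 else 11)"
    by (rule cycle_all_residue[where s = "\<lambda>j. jacobsthal (j + 4)" and T = 2
        and P = "\<lambda>i x. x = (if even i then 5 else 11)", OF jacobsthal_shift_rec]) (simp_all add: jacobsthal_values)
  then show ?thesis by (simp add: n dvd_mod_iff)
qed

lemma jacobsthal_mod_64:
  assumes "n \<ge> 6"
  shows "jacobsthal n mod 64 = (if even n then 21 else 43)"
proof -
  obtain j where n: "n = j + 6" using assms by (metis add.commute le_Suc_ex)
  have "jacobsthal (j + 6) mod 64 = (if even (j mod 2) then 21 else 43)"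
    by (rule cycle_all_residue[where s = "\<lambda>j. jacobsthal (j + 6)" and T = 2
        and P = "\<lambda>i x. x = (if even i then 21 else 43)", OF jacobsthal_shift_rec]) (simp_all add: jacobsthal_values)
  then show ?thesis by (simp add: n dvd_mod_iff)
qed

section \<open>Excluding large indices\<close>

lemma jacobsthal_ne_lucas:
  assumes "n \<ge> 6"
  shows "jacobsthal n \<noteq> lucas k"
proof
  assume eq: "jacobsthal n = lucas k"
  show False
  proof (cases "even n")
    case True
    then have "k mod 4 = 3"
      using jacobsthal_mod_64[OF assms] lucas_mod_64_eq_21[of k] eq by simp
    then show False
      using lucas_mod_37[of k] jacobsthal_mod_37[OF True] eq by simp
  next
    case False
    then have "k mod 48 \<in> {14, 34} \<or> k mod 32 = 21"
      using jacobsthal_mod_64[OF assms] lucas_mod_64_eq_43[of k] eq by simp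
    then show False
      using lucas_mod_23[of k] lucas_mod_47[of k] odd_jacobsthal_mod_23[OF False]
        odd_jacobsthal_mod_47[OF False] eq by auto
  qed
qed

lemma Suc_jacobsthal_ne_lucas:
  assumes "n \<ge> 6"
  shows "jacobsthal n + 1 \<noteq> lucas k"
proof
  assume eq: "jacobsthal n + 1 = lucas k"
  have "odd n"
  proof
    assume "even n"
    then have "jacobsthal n mod 16 = 5"
      using jacobsthal_mod_16[of n] assms by simp
    then have "(jacobsthal n + 1) mod 16 = 6" by (simp add: mod_Suc)
    with lucas_mod_16[of k] eq show False by simp
  qed
  then have "(jacobsthal n + 1) mod 64 = 44"
    using jacobsthal_mod_64[OF assms] by (simp add: mod_Suc)
  then have "(jacobsthal n + 1) mod 7 = 1"
    using lucas_mod_64_eq_44 lucas_mod_7 eq by metis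
  then have "jacobsthal n mod 7 = 0" by presburger
  with odd_jacobsthal_mod_7[OF \<open>odd n\<close>] show False by simp
qed

lemma jacobsthal_add_ne_lucas:
  assumes "n \<ge> 4" "m \<ge> 3"
  shows "jacobsthal n + jacobsthal m \<noteq> lucas k"
proof
  assume eq: "jacobsthal n + jacobsthal m = lucas k"
  have "jacobsthal m mod 16 \<in> {3, 5, 11}"
  \<comment> \<open>J_3 = 3 precedes the regular pattern modulo 16.\<close>
  proof (cases "m = 3")
    case True
    then show ?thesis by (simp add: jacobsthal_values)
  next
    case False
    with \<open>m \<ge> 3\<close> have "m \<ge> 4" by simp
    then show ?thesis using jacobsthal_mod_16[of m] by simp
  qed
  moreover have "jacobsthal n mod 16 \<in> {5, 11}"
    using jacobsthal_mod_16[OF \<open>n \<ge> 4\<close>] by simp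
  ultimately have "(jacobsthal n + jacobsthal m) mod 16 \<in> {0, 6, 8, 10, 14}"
    by (subst mod_add_eq[symmetric]) auto
  with lucas_mod_16[of k] eq show False by simp
qed

text \<open>29 = L_7 exceeds 22 = 2 J_5, which bounds \<open>k\<close> once \<open>n\<close> is at
  most 5.\<close>

lemma lucas_ge_29: "lucas (k + 7) \<ge> 29"
  by (induction k rule: lucas.induct) (simp_all add: eval_nat_numeral)

lemma lucas_values:
  "lucas 1 = 1" "lucas 2 = 3" "lucas 3 = 4" "lucas 4 = 7" "lucas 5 = 11" "lucas 6 = 18"
  by (simp_all add: eval_nat_numeral)

text \<open>Explicit index sets let \<open>simp\<close> expand the search into ground cases.\<close>

lemma small_solutions:
  "\<forall>n\<in>{0,1,2,3,4,5}. \<forall>m\<in>{0,1,2,3,4,5}. \<forall>k\<in>{0,1,2,3,4,5,6}.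
    m \<le> n \<longrightarrow> jacobsthal n + jacobsthal m = lucas k \<longrightarrow>
    (n, m, k) \<in> {(1, 1, 0), (2, 1, 0), (2, 2, 0), (1, 0, 1), (2, 0, 1), (3, 0, 2), (3, 1, 3), (3, 2, 3), (5, 0, 5)}"
  by (simp (no_asm) only: ball_simps simp_thms)
    (simp (no_asm) add: jacobsthal_values lucas_values)

theorem theorem1p1:
  shows "{(n :: nat, m :: nat, k :: nat). n \<ge> m \<and> jacobsthal n + jacobsthal m = lucas k} =
    {(1, 1, 0), (2, 1, 0), (2, 2, 0), (1, 0, 1), (2, 0, 1), (3, 0, 2), (3, 1, 3), (3, 2, 3), (5, 0, 5)}"
    (is "?S = ?R")
proof
  show "?R \<subseteq> ?S" by (simp add: jacobsthal_values lucas_values)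
  show "?S \<subseteq> ?R"
  proof (rule subsetI)
    fix p
    assume "p \<in> ?S"
    obtain n m k where p: "p = (n, m, k)" by (rule prod_cases3)
    with \<open>p \<in> ?S\<close> have "m \<le> n" and eq: "jacobsthal n + jacobsthal m = lucas k" by simp_all
    have "n < 6"
    proof (rule ccontr)
      assume "\<not> n < 6"
      then have n: "n \<ge> 6" by simp
      with jacobsthal_add_ne_lucas[of n m k] eq have "m < 3" by fastforce
      then have "m \<in> {0, 1, 2}" by auto
      then have "jacobsthal m = 0 \<or> jacobsthal m = 1"
        by (auto simp: jacobsthal_values)
      with jacobsthal_ne_lucas[OF n, of k] Suc_jacobsthal_ne_lucas[OF n, of k] eq
      show False by auto
    qed
    then have n: "n \<in> {0,1,2,3,4,5}" by auto
    with \<open>m \<le> n\<close> have m: "m \<in> {0,1,2,3,4,5}" by auto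
    have "k < 7"
    proof (rule ccontr)
      assume "\<not> k < 7"
      then have "lucas k \<ge> 29" using lucas_ge_29[of "k - 7"] by simp
      moreover from n m have "jacobsthal n \<le> 11" "jacobsthal m \<le> 11"
        by (auto simp: jacobsthal_values)
      ultimately show False using eq by simp
    qed
    then have k: "k \<in> {0,1,2,3,4,5,6}" by auto
    show "p \<in> ?R"
      unfolding p by (rule small_solutions[rule_format, OF n m k \<open>m \<le> n\<close> eq])
  qed
qed

end
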